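(* Let $k\ge2$ and $N=d-k+1\ge0$, and let $\mathbf s=(s_1,\dots,s_k)\in T_N^k$. Then the numbers $E_{\mathbf s}$ are log-concave along root directions; that is, for all $1\le i<j\le k$, $$E_{\mathbf s}^2\ \ge\ E_{\mathbf s-\mathbf e_i+\mathbf e_j}\cdot E_{\mathbf s+\mathbf e_i-\mathbf e_j}.$$
   Context: For $k\ge1$ and $N\ge0$, $T_N^k=\{(s_1,\dots,s_k)\in\mathbb Z_{\ge0}^k: s_1+\cdots+s_k=N\}$; $\mathbf e_i$ is the $i$-th standard basis vector of $\mathbb Z^k$. For $k,m\ge1$, the distance graph $G(k,m)$ is the directed graph on vertex set $\{1,\dots,m\}$ with slack edges $(i,i+1)$ for $1\le i\le m-1$ and non-slack edges $(i,i+k)$ for $1\le i\le m-k$ (none if $m\le k$). An integral $\mathbf a$-flow on a directed graph on $\{1,\dots,m\}$ is an assignment of nonnegative integers $f_e$ to the edges such that at every vertex $i$ the total outgoing flow minus the total incoming flow equals $a_i$. $k$-Entringer numbers: let $k\ge2$, $N=d-k+1\ge0$ and $\mathbf s=(s_1,\dots,s_k)\in T_N^k$. $E_{\mathbf s}$ is the number of integral flows on $G(k,d)$ with net flow $(1^{d-1},-d+1)$ (entries $1$ at vertices $1,\dots,d-1$ and $-(d-1)$ at vertex $d$) whose flow on the slack edge $(d-k+1,d-k+2)$ is $s_1$ and whose flows on the last $k-1$ non-slack edges, read from right to left, are $s_2,\dots,s_k$; that is, the flow on $(N-i,N-i+k)$ is $s_{i+1}$ for $i=1,\dots,k-1$.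 If such an edge does not exist because its tail would be $\le 0$ (small $N$), the flow on it is taken to be $0$. By convention $E_{\mathbf t}=0$ if $\mathbf t$ has a negative entry. *)

theory Defs
  imports "Graph_Theory.Digraph" "HOL-Library.Function_Algebras"
begin

text \<open>
  Vectors of \<open>\<int>\<^sup>k\<close> are functions \<open>nat \<Rightarrow> int\<close> that vanish outside \<open>{1..k}\<close>, with the pointwise
  operations of \<^theory>\<open>HOL-Library.Function_Algebras\<close>.
\<close>

definition lattice_simplex :: "nat \<Rightarrow> nat \<Rightarrow> (nat \<Rightarrow> int) set" where
  "lattice_simplex k N =
     {s. (\<forall>l\<in>{1..k}. 0 \<le> s l) \<and> (\<forall>l. l \<notin> {1..k} \<longrightarrow> s l = 0) \<and> (\<Sum>l=1..k. s l) = int N}"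

definition basis_vec :: "nat \<Rightarrow> nat \<Rightarrow> int" where
  "basis_vec i = (\<lambda>l. if l = i then 1 else 0)"

text \<open>
  An arc is named by its kind and its tail, so that for \<open>k = 1\<close> the slack and the non-slack arcs
  from \<open>i\<close> to \<open>i + 1\<close> are distinct parallel arcs.
\<close>

datatype dist_arc = Slack nat | NonSlack nat

definition distance_graph :: "nat \<Rightarrow> nat \<Rightarrow> (nat, dist_arc) pre_digraph" where
  "distance_graph k m =
     \<lparr> verts = {1..m},
       arcs = {Slack i | i. 1 \<le> i \<and> i + 1 \<le> m} \<union> {NonSlack i | i. 1 \<le> i \<and> i + k \<le> m},
       tail = (\<lambda>e. case e of Slack i \<Rightarrow> i | NonSlack i \<Rightarrow> i),
       head = (\<lambda>e. case e of Slack i \<Rightarrow> i + 1 | NonSlack i \<Rightarrow> i + k) \<rparr>"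

text \<open>
  A flow is extended by \<open>0\<close> to arc names that are not arcs of the graph. So distinct elements
  of this set are distinct as assignments to the arcs.
\<close>

definition integral_flows :: "('v, 'e) pre_digraph \<Rightarrow> ('v \<Rightarrow> int) \<Rightarrow> ('e \<Rightarrow> nat) set" where
  "integral_flows G a =
     {f. (\<forall>e. e \<notin> arcs G \<longrightarrow> f e = 0) \<and>
         (\<forall>v\<in>verts G. (\<Sum>e\<in>out_arcs G v. int (f e)) - (\<Sum>e\<in>in_arcs G v. int (f e)) = a v)}"

text \<open>The net flow \<open>(1, \<dots>, 1, -d + 1)\<close> on the vertices \<open>1, \<dots>, d\<close>.\<close>

definition entringer_netflow :: "nat \<Rightarrow> nat \<Rightarrow> int" where
  "entringer_netflow d v = (if v = d then - int d + 1 else 1)"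

text \<open>
  For \<open>2 \<le> k \<le> d + 1\<close>. The subtractions on \<^typ>\<open>nat\<close> are harmless: \<open>d + 1 - k\<close> is \<open>N\<close>, and if
  \<open>N \<le> i\<close> then \<open>NonSlack (N - i)\<close> is \<open>NonSlack 0\<close>, which is not an arc, so every flow is \<open>0\<close>
  on it, as the convention for missing edges requires; likewise for \<open>Slack N\<close> if \<open>N = 0\<close>.
  The set counted is finite, since every arc leads to a larger vertex and the outflow of a vertex
  is determined by its inflow.
\<close>

definition entringer :: "nat \<Rightarrow> nat \<Rightarrow> (nat \<Rightarrow> int) \<Rightarrow> nat" where
  "entringer k d s =
     (let N = d + 1 - k in
      if \<exists>l\<in>{1..k}. s l < 0 then 0
      else card {f \<in> integral_flows (distance_graph k d) (entringer_netflow d).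
                   int (f (Slack N)) = s 1 \<and>
                   (\<forall>i\<in>{1..k - 1}. int (f (NonSlack (N - i))) = s (i + 1))})"

end

(*
  Splitting the flows according to the flow u on the arc (N - k, N) gives the recursion
    E^N(s_1, ..., s_k) = sum over 0 <= u < s_1 of E^(N-1)(s_1 + s_2 - 1 - u, s_3, ..., s_k, u).
  By induction on N, every matrix H^N_t = (E^N(t + e_i + e_j))_(i,j) has at most one positive
  eigenvalue; the 2x2 minors of these matrices are the claim. In the induction step one shows
  that H^N_t is negative semidefinite on the orthogonal complement of its second column. Take x
  in this complement. Up to a nonpositive sum of squares, the value of H^N_t at x is the sum over
  u < t_1 of the forms H^(N-1) at (t_1 + t_2 - 1 - u, t_3, ..., t_k, u), evaluated at vectors in
  which the contribution of x_1 + x_2 to the coordinates 1 and k may be chosen freely subject to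
  a chain condition. They can be chosen orthogonal to the first columns of these forms, so each
  summand is nonpositive by induction.
*)

theory Submission
  imports Defs Complex_Main
begin

section \<open>Quadratic forms\<close>

definition hess_form :: "'a set \<Rightarrow> ('a \<Rightarrow> 'a \<Rightarrow> real) \<Rightarrow> ('a \<Rightarrow> real) \<Rightarrow> ('a \<Rightarrow> real) \<Rightarrow> real" where
  "hess_form J a x y = (\<Sum>i\<in>J. \<Sum>j\<in>J. x i * y j * a i j)"

text \<open>For symmetric matrices this says that there is at most one positive eigenvalue. A single
  linear functional \<open>w\<close>, on whose kernel the form is nonpositive, replaces spectral
  theory.\<close>

definition lorentzian :: "'a set \<Rightarrow> ('a \<Rightarrow> 'a \<Rightarrow> real) \<Rightarrow> bool" where
  "lorentzian J a \<longleftrightarrow>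
     (\<exists>w. \<forall>x. (\<Sum>i\<in>J. w i * x i) = 0 \<longrightarrow> hess_form J a x x \<le> 0)"

lemma hess_form_commute:
  assumes "\<And>i j. a i j = a j i"
  shows "hess_form J a x y = hess_form J a y x"
  unfolding hess_form_def
  by (subst sum.swap) (simp add: assms[of _ _] mult.commute)

lemma hess_form_add_scaled:
  assumes "\<And>i j. a i j = a j i"
  shows "hess_form J a (\<lambda>i. x i + c * v i) (\<lambda>i. x i + c * v i) =
    hess_form J a x x + 2 * c * hess_form J a v x + c\<^sup>2 * hess_form J a v v"
proof -
  have "hess_form J a (\<lambda>i. x i + c * v i) (\<lambda>i. x i + c * v i) =
    hess_form J a x x + c * hess_form J a x v + c * hess_form J a v x + c\<^sup>2 * hess_form J a v v"
    unfolding hess_form_def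
    by (simp add: algebra_simps sum.distrib sum_distrib_left power2_eq_square)
  then show ?thesis
    using hess_form_commute[of a J x v] assms by simp
qed

text \<open>A vector \<open>v\<close> of positive value lies outside the kernel of the functional,
  so adding a multiple \<open>c\<close> of \<open>v\<close> moves \<open>x\<close> into that kernel.
  By orthogonality this changes the value at \<open>x\<close> only by the nonnegative term
  \<open>c\<^sup>2 * hess_form J a v v\<close>.\<close>

lemma lorentzian_orthogonal_nonpos:
  assumes "lorentzian J a" and sym: "\<And>i j. a i j = a j i"
    and v: "hess_form J a v v > 0" and vx: "hess_form J a v x = 0"
  shows "hess_form J a x x \<le> 0"
proof -
  from assms(1) obtain w
    where w: "\<And>x. (\<Sum>i\<in>J. w i * x i) = 0 \<Longrightarrow> hess_form J a x x \<le> 0"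
    unfolding lorentzian_def by blast
  define \<phi> where "\<phi> x = (\<Sum>i\<in>J. w i * x i)" for x
  have nz: "\<phi> v \<noteq> 0" using w[of v] v unfolding \<phi>_def by force
  define c where "c = - \<phi> x / \<phi> v"
  have "\<phi> (\<lambda>i. x i + c * v i) = \<phi> x + c * \<phi> v"
    unfolding \<phi>_def by (simp add: algebra_simps sum.distrib sum_distrib_left)
  also have "\<dots> = 0" using nz by (simp add: c_def)
  finally have "hess_form J a (\<lambda>i. x i + c * v i) (\<lambda>i. x i + c * v i) \<le> 0"
    unfolding \<phi>_def by (rule w)
  then have "hess_form J a x x + c\<^sup>2 * hess_form J a v v \<le> 0"
    using hess_form_add_scaled[of a J x c v] sym vx by simp
  moreover have "c\<^sup>2 * hess_form J a v v \<ge> 0" using v by simp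
  ultimately show ?thesis by linarith
qed

lemma hess_form_indicator:
  assumes "finite J" "i \<in> J"
  shows "hess_form J a (\<lambda>l. if l = i then 1 else 0) x = (\<Sum>j\<in>J. x j * a i j)"
proof -
  have "hess_form J a (\<lambda>l. if l = i then 1 else 0) x =
      (\<Sum>l\<in>J. if l = i then (\<Sum>j\<in>J. x j * a i j) else 0)"
    unfolding hess_form_def by (intro sum.cong) auto
  then show ?thesis using assms by simp
qed

text \<open>Reverse Cauchy-Schwarz for basis vectors: if \<open>a i i > 0\<close>, the component of
  \<open>e j\<close> orthogonal to \<open>e i\<close> has the value
  \<open>a j j - (a i j)\<^sup>2 / a i i\<close>, which cannot be positive.\<close>

lemma lorentzian_minor:
  assumes "lorentzian J a" and sym: "\<And>i j. a i j = a j i"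
    and J: "finite J" "i \<in> J" "j \<in> J" and nonneg: "\<And>i j. a i j \<ge> 0"
  shows "a i i * a j j \<le> (a i j)\<^sup>2"
proof (cases "a i i = 0")
  case False
  then have pos: "a i i > 0" using nonneg[of i i] by linarith
  define e :: "'a \<Rightarrow> 'a \<Rightarrow> real" where "e = (\<lambda>i l. if l = i then 1 else 0)"
  have H: "hess_form J a (e p) (e q) = a p q" if "p \<in> J" "q \<in> J" for p q
    unfolding e_def using hess_form_indicator[OF J(1) that(1)] that J
    by (simp add: if_distrib[of "\<lambda>x. x * _"] cong: if_cong)
  define c where "c = - a i j / a i i"
  have lin: "hess_form J a (e i) (\<lambda>l. e j l + c * e i l) = 0"
  proof -
    have "hess_form J a (e i) (\<lambda>l. e j l + c * e i l) =
        hess_form J a (e i) (e j) + c * hess_form J a (e i) (e i)"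
      unfolding hess_form_def
      by (simp add: algebra_simps sum.distrib sum_distrib_left)
    then show ?thesis using pos by (simp add: H J c_def)
  qed
  have "hess_form J a (\<lambda>l. e j l + c * e i l) (\<lambda>l. e j l + c * e i l) \<le> 0"
    using lorentzian_orthogonal_nonpos[OF assms(1) sym _ lin] pos by (simp add: H J)
  then have "a j j + 2 * c * a i j + c\<^sup>2 * a i i \<le> 0"
    by (simp add: hess_form_add_scaled[OF sym] H J)
  then have "(a j j + 2 * c * a i j + c\<^sup>2 * a i i) * a i i \<le> 0"
    using pos by (simp add: mult_le_0_iff)
  then show ?thesis using pos by (simp add: c_def field_simps power2_eq_square)
qed simp

text \<open>Serves two splittings of \<open>{1..k}\<close>: 1, 2 and the shifted rest at level
  \<open>Suc N\<close>; \<open>k\<close>, 1 and the unshifted rest at level \<open>N\<close>. The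
  map \<open>\<sigma>\<close> lets both expansions run over the same index set
  \<open>{2..<k}\<close>.\<close>

lemma hess_form_split:
  fixes a :: "'a \<Rightarrow> 'a \<Rightarrow> real"
  assumes split: "\<And>f :: 'a \<Rightarrow> real. sum f J = f \<alpha> + f \<beta> + (\<Sum>l\<in>I. f (\<sigma> l))"
    and sym: "\<And>i j. a i j = a j i"
  shows "hess_form J a x x =
    (x \<alpha>)\<^sup>2 * a \<alpha> \<alpha> + 2 * x \<alpha> * x \<beta> * a \<alpha> \<beta> + (x \<beta>)\<^sup>2 * a \<beta> \<beta>
    + 2 * x \<alpha> * (\<Sum>l\<in>I. x (\<sigma> l) * a \<alpha> (\<sigma> l)) + 2 * x \<beta> * (\<Sum>l\<in>I. x (\<sigma> l) * a \<beta> (\<sigma> l))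
    + (\<Sum>l\<in>I. \<Sum>l'\<in>I. x (\<sigma> l) * x (\<sigma> l') * a (\<sigma> l) (\<sigma> l'))"
  unfolding hess_form_def split
  by (simp add: sum.distrib sum_distrib_left algebra_simps power2_eq_square sym[of "\<sigma> _" \<alpha>]
      sym[of "\<sigma> _" \<beta>] sym[of \<beta> \<alpha>])

section \<open>Partial sums\<close>

text \<open>
  In the induction step below, \<open>w\<close> is the value that makes the vector \<open>(\<zeta> - w, z)\<close> orthogonal to
  the first column of the form with index \<open>n\<close>. The two sides then differ by \<open>r (n + 1) (z - w)\<^sup>2\<close>.
\<close>

lemma partial_sums_nonpos:
  fixes r l m :: "nat \<Rightarrow> real"
  assumes "\<And>u p q. \<lbrakk>u < n; r u > 0; r u * q + r (Suc u) * p + l u = 0\<rbrakk> \<Longrightarrow>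
      p\<^sup>2 * r (Suc (Suc u)) + 2 * p * q * r (Suc u) + q\<^sup>2 * r u
        + 2 * p * l (Suc u) + 2 * q * l u + m u \<le> 0"
    and "\<And>u. r u \<ge> 0"
    and "\<And>u. \<lbrakk>u \<le> n; r u = 0\<rbrakk> \<Longrightarrow> r (Suc u) = 0 \<and> l u = 0"
    and "\<And>u. \<lbrakk>u < n; r u = 0\<rbrakk> \<Longrightarrow> m u = 0"
    and "\<zeta> * (\<Sum>u<n. r u) + (\<Sum>u<n. l u) + r n * z = 0"
  shows "\<zeta>\<^sup>2 * (\<Sum>u<n. r u) + 2 * \<zeta> * (\<Sum>u<n. l u) + (\<Sum>u<n. m u)
    + r n * (2 * \<zeta> * z - z\<^sup>2) + r (Suc n) * z\<^sup>2 + 2 * z * l n \<le> 0"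
  using assms
proof (induction n arbitrary: z)
  case 0
  \<comment> \<open>The last assumption reads \<open>r 0 * z = 0\<close>: either
    \<open>z = 0\<close>, or all remaining coefficients vanish with \<open>r 0\<close>.\<close>
  then show ?case by (cases "r 0 = 0") auto
next
  case (Suc n)
  note h = Suc.prems(1) and nonneg = Suc.prems(2) and zero = Suc.prems(3) and mzero = Suc.prems(4)
    and hyper = Suc.prems(5)
  have IH: "\<zeta>\<^sup>2 * (\<Sum>u<n. r u) + 2 * \<zeta> * (\<Sum>u<n. l u) + (\<Sum>u<n. m u)
    + r n * (2 * \<zeta> * w - w\<^sup>2) + r (Suc n) * w\<^sup>2 + 2 * w * l n \<le> 0"
    if "\<zeta> * (\<Sum>u<n. r u) + (\<Sum>u<n. l u) + r n * w = 0" for w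
    by (rule Suc.IH) (use h nonneg zero mzero that in auto)
  show ?case
  proof (cases "r n = 0")
    case True
    \<comment> \<open>Every coefficient in which the claim for \<open>Suc n\<close> differs from
      that for \<open>n\<close> vanishes, so the induction hypothesis suffices, and any
      \<open>w\<close> will do in it.\<close>
    then have "r (Suc n) = 0" "l n = 0" "m n = 0" using zero[of n] mzero[of n] by auto
    moreover have "r (Suc (Suc n)) = 0" "l (Suc n) = 0" using zero[of "Suc n"] calculation by auto
    ultimately show ?thesis using True hyper IH[of 0] by simp
  next
    case False
    then have pos: "r n > 0" using nonneg[of n] by linarith
    define w where "w = - (\<zeta> * (\<Sum>u<n. r u) + (\<Sum>u<n. l u)) / r n"
    have w: "\<zeta> * (\<Sum>u<n. r u) + (\<Sum>u<n. l u) + r n * w = 0"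
      using pos by (simp add: w_def field_simps)
    \<comment> \<open>The difference of \<open>hyper\<close> and \<open>w\<close> is the
      orthogonality condition of the form with index \<open>n\<close>, for \<open>p = z\<close> and
      \<open>q = \<zeta> - w\<close>.\<close>
    have "r n * (\<zeta> - w) + r (Suc n) * z + l n = 0"
      using hyper w by (simp add: algebra_simps)
    from h[OF _ pos this]
    have "z\<^sup>2 * r (Suc (Suc n)) + 2 * z * (\<zeta> - w) * r (Suc n) + (\<zeta> - w)\<^sup>2 * r n
        + 2 * z * l (Suc n) + 2 * (\<zeta> - w) * l n + m n \<le> 0" by simp
    moreover note IH[OF w]
    moreover have "r (Suc n) * (z - w)\<^sup>2 \<ge> 0" using nonneg[of "Suc n"] by simp
    ultimately show ?thesis by (simp add: algebra_simps power2_eq_square)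
  qed
qed

section \<open>The recursion\<close>

definition evec :: "nat \<Rightarrow> nat \<Rightarrow> nat" where
  "evec i = (\<lambda>l. if l = i then 1 else 0)"

text \<open>
  \<open>ent k N s\<close> is the number \<open>E\<^sub>s\<close> if \<open>s\<close> has sum \<open>N\<close>. The subtraction in its
  recursion does not truncate, as \<open>u < s 1\<close>.
\<close>

definition state :: "nat \<Rightarrow> nat \<Rightarrow> (nat \<Rightarrow> nat) \<Rightarrow> nat \<Rightarrow> nat \<Rightarrow> nat" where
  "state k a s u =
     (\<lambda>l. if l = 1 then a else if l = k then u else if 2 \<le> l \<and> l < k then s (Suc l) else 0)"

fun ent :: "nat \<Rightarrow> nat \<Rightarrow> (nat \<Rightarrow> nat) \<Rightarrow> nat" where
  "ent k 0 s = (if \<forall>l\<in>{1..k}. s l = 0 then 1 else 0)"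
| "ent k (Suc N) s = (\<Sum>u<s 1. ent k N (state k (s 1 + s 2 - 1 - u) s u))"

text \<open>The vector argument of \<open>state\<close> is read only at the coordinates from 3 to
  \<open>k\<close>; the first two enter through \<open>a\<close>.\<close>

lemma state_evec [simp]:
  "state k a (s + evec (Suc 0)) u = state k a s u"
  "state k a (s + evec 2) u = state k a s u"
  by (auto simp: state_def evec_def)

lemma state_evec_Suc:
  "l \<in> {2..<k} \<Longrightarrow> state k a (s + evec (Suc l)) u = state k a s u + evec l"
  by (auto simp: state_def evec_def)

lemma state_Suc_first: "state k (Suc a) s u = state k a s u + evec 1"
  by (auto simp: state_def evec_def)

lemma state_Suc_last: "k \<ge> 2 \<Longrightarrow> state k a s (Suc u) = state k a s u + evec k"
  by (auto simp: state_def evec_def)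

lemma evec_apply: "evec i l = (if l = i then 1 else 0)"
  by (auto simp: evec_def)

lemma ent_Suc_pos_iff:
  "ent k (Suc N) s > 0 \<longleftrightarrow> (\<exists>u<s 1. ent k N (state k (s 1 + s 2 - 1 - u) s u) > 0)"
  by (auto simp flip: neq0_conv)

text \<open>A positive summand of the recursion stays positive for the same \<open>u\<close>: a unit
  at coordinate 2 enters only through \<open>s 1 + s 2\<close>, and a unit at \<open>Suc l\<close>
  becomes one at \<open>l\<close>, which the induction hypothesis moves to coordinate 1. This
  provides the vanishing conditions of \<open>partial_sums_nonpos\<close>.\<close>

lemma ent_support:
  assumes "k \<ge> 2" "j \<in> {1..k}" "ent k N (s + evec j) > 0"
  shows "ent k N (s + evec 1) > 0"
  using assms(2,3)
proof (induction N arbitrary: s j)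
  case 0
  then show ?case by (auto simp: evec_def split: if_splits)
next
  case (Suc N)
  from Suc.prems obtain u where u: "u < (s + evec j) 1"
    and pos: "ent k N (state k ((s + evec j) 1 + (s + evec j) 2 - 1 - u) (s + evec j) u) > 0"
    unfolding ent_Suc_pos_iff by blast
  consider "j = 1" | "j = 2" | l where "l \<in> {2..<k}" "j = Suc l"
    using Suc.prems(1) by (cases j) (auto, force)
  then show ?case
  proof cases
    case 1
    then show ?thesis using Suc.prems by simp
  next
    case 2
    then have "ent k N (state k ((s + evec 1) 1 + (s + evec 1) 2 - 1 - u) (s + evec 1) u) > 0"
      "u < (s + evec 1) 1"
      using pos u by (simp_all add: evec_apply)
    then show ?thesis unfolding ent_Suc_pos_iff by blast
  next
    case 3
    then have us: "u < s 1" using u by (simp add: evec_apply)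
    have "ent k N (state k (s 1 + s 2 - 1 - u) s u + evec l) > 0"
      using pos 3 by (simp add: state_evec_Suc evec_apply)
    then have "ent k N (state k (s 1 + s 2 - 1 - u) s u + evec 1) > 0"
      by (rule Suc.IH[rotated]) (use 3 in auto)
    moreover have "s 1 + s 2 - u = Suc (s 1 + s 2 - 1 - u)" using us by simp
    ultimately have "ent k N (state k ((s + evec 1) 1 + (s + evec 1) 2 - 1 - u) (s + evec 1) u) > 0"
      "u < (s + evec 1) 1"
      using us by (simp_all add: evec_apply state_Suc_first)
    then show ?thesis unfolding ent_Suc_pos_iff by blast
  qed
qed

section \<open>Signature of the Hessian matrices\<close>

lemma sum_split_first_last:
  fixes f :: "nat \<Rightarrow> real"
  assumes "k \<ge> 2"
  shows "(\<Sum>i=1..k. f i) = f k + f 1 + (\<Sum>l=2..<k. f l)"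
proof -
  have "{1..k} = insert k (insert 1 {2..<k})" using assms by auto
  then show ?thesis using assms by simp
qed

lemma sum_split_first_two:
  fixes f :: "nat \<Rightarrow> real"
  assumes "k \<ge> 2"
  shows "(\<Sum>i=1..k. f i) = f 1 + f 2 + (\<Sum>l=2..<k. f (Suc l))"
proof -
  have "{1..k} = insert 1 (insert 2 {Suc 2..<Suc k})" using assms by auto
  then have "(\<Sum>i=1..k. f i) = f 1 + (f 2 + sum f {Suc 2..<Suc k})" by simp
  then show ?thesis by (simp only: sum.shift_bounds_Suc_ivl add.assoc)
qed

text \<open>For \<open>t\<close> of sum N - 2 this is the Hessian of the quadratic form left after
  differentiating the sum of \<open>ent k N s\<close> x^s / s! over all s of sum N to the order
  \<open>t\<close>.\<close>

abbreviation ent_hess :: "nat \<Rightarrow> nat \<Rightarrow> (nat \<Rightarrow> nat) \<Rightarrow> nat \<Rightarrow> nat \<Rightarrow> real" where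
  "ent_hess k N t i j \<equiv> real (ent k N (t + evec i + evec j))"

lemma ent_hess_commute: "ent_hess k N t i j = ent_hess k N t j i"
  by (simp add: ac_simps)

text \<open>Induction on \<open>N\<close> with the second column as the witness functional:
  orthogonality to it is the linear equation that \<open>partial_sums_nonpos\<close> assumes. At
  level 0 all entries vanish, because \<open>t + evec i + evec j\<close> is nonzero.\<close>

lemma ent_lorentzian:
  assumes k: "k \<ge> 2"
  shows "lorentzian {1..k} (ent_hess k N t)"
proof (induction N arbitrary: t)
  case 0
  have "ent_hess k 0 t i j = 0" if "i \<in> {1..k}" for i j
    using that by (auto simp: evec_def)
  then have "hess_form {1..k} (ent_hess k 0 t) x x = 0" for x
    unfolding hess_form_def by (intro sum.neutral ballI) simp
  then show ?case unfolding lorentzian_def by simp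
next
  case (Suc N)
  define n c where "n = t 1" and "c = t 1 + t 2"
  \<comment> \<open>For \<open>u < n\<close> these are the entries (1,1), (1,i) and (i,j) of the
    level \<open>N\<close> matrix at \<open>state k (c - 1 - u) t u\<close>. Raising
    \<open>u\<close> by one trades a unit at coordinate 1 for one at \<open>k\<close>, so
    \<open>r (Suc u)\<close>, \<open>r (Suc (Suc u))\<close> and \<open>l i (Suc u)\<close> are its
    entries (k,1), (k,k) and (k,i).\<close>
  define r where "r u = real (ent k N (state k (c + 1 - u) t u))" for u
  define l where "l i u = real (ent k N (state k (c - u) t u + evec i))" for i u
  define m where "m i j u = real (ent k N (state k (c - 1 - u) t u + evec i + evec j))" for i j u
  have n1: "t (Suc 0) = n" by (simp add: n_def)
  have nc: "n \<le> c" by (simp add: n_def c_def)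
  \<comment> \<open>Adding \<open>evec 1\<close> or \<open>evec 2\<close> raises
    \<open>t 1 + t 2\<close>, but only \<open>evec 1\<close> lengthens the range of
    \<open>u\<close>; hence the boundary terms at \<open>n\<close> and \<open>Suc n\<close>.\<close>
  have H11: "ent_hess k (Suc N) t 1 1 = (\<Sum>u<n. r u) + r n + r (Suc n)"
    and H12: "ent_hess k (Suc N) t 1 2 = (\<Sum>u<n. r u) + r n"
    and H22: "ent_hess k (Suc N) t 2 2 = (\<Sum>u<n. r u)"
    by (simp_all add: evec_apply n1 r_def c_def)
  have H1l: "ent_hess k (Suc N) t 1 (Suc i) = (\<Sum>u<n. l i u) + l i n"
    and H2l: "ent_hess k (Suc N) t 2 (Suc i) = (\<Sum>u<n. l i u)"
    if "i \<in> {2..<k}" for i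
    using that
    by (simp_all add: evec_apply n1 l_def c_def
        state_evec_Suc)
  have Hll: "ent_hess k (Suc N) t (Suc i) (Suc j) = (\<Sum>u<n. m i j u)"
    if "i \<in> {2..<k}" "j \<in> {2..<k}" for i j
    using that
    by (simp add: evec_apply n1 m_def c_def
        state_evec_Suc)
  have nonneg: "r u \<ge> 0" for u by (simp add: r_def)
  have "hess_form {1..k} (ent_hess k (Suc N) t) x x \<le> 0"
    if orth: "(\<Sum>i=1..k. ent_hess k (Suc N) t 2 i * x i) = 0" for x
  proof -
    define L where "L u = (\<Sum>i=2..<k. x (Suc i) * l i u)" for u
    define M where "M u = (\<Sum>i=2..<k. \<Sum>j=2..<k. x (Suc i) * x (Suc j) * m i j u)" for u
    have sumL: "(\<Sum>u<n. L u) = (\<Sum>i=2..<k. x (Suc i) * (\<Sum>u<n. l i u))"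
      unfolding L_def by (subst sum.swap) (simp add: sum_distrib_left)
    have sumM: "(\<Sum>u<n. M u) = (\<Sum>i=2..<k. \<Sum>j=2..<k. x (Suc i) * x (Suc j) * (\<Sum>u<n. m i j u))"
      unfolding M_def sum_distrib_left
      by (subst sum.swap, rule sum.cong, simp, subst sum.swap, simp)
    \<comment> \<open>Outside the boundary terms, \<open>x 1\<close> and \<open>x 2\<close> occur
      only through their sum.\<close>
    define \<zeta> where "\<zeta> = x 1 + x 2"
    have hyper: "\<zeta> * (\<Sum>u<n. r u) + (\<Sum>u<n. L u) + r n * x 1 = 0"
    proof -
      have "(\<Sum>l=2..<k. ent_hess k (Suc N) t 2 (Suc l) * x (Suc l)) = (\<Sum>u<n. L u)"
        unfolding sumL by (intro sum.cong) (simp_all add: H2l del: ent.simps)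
      then show ?thesis
        using orth unfolding sum_split_first_two[OF k] H22 \<zeta>_def
          ent_hess_commute[of k "Suc N" t 2 1] H12
        by (simp add: algebra_simps)
    qed
    have "\<zeta>\<^sup>2 * (\<Sum>u<n. r u) + 2 * \<zeta> * (\<Sum>u<n. L u) + (\<Sum>u<n. M u)
      + r n * (2 * \<zeta> * x 1 - (x 1)\<^sup>2) + r (Suc n) * (x 1)\<^sup>2 + 2 * x 1 * L n \<le> 0"
    proof (rule partial_sums_nonpos)
      fix u p q
      assume u: "u < n" and pos: "r u > 0" and orth: "r u * q + r (Suc u) * p + L u = 0"
      define S where "S = state k (c - 1 - u) t u"
      \<comment> \<open>Coordinate \<open>Suc i\<close> of \<open>t\<close> sits at \<open>i\<close>
        in \<open>S\<close>, so \<open>x (Suc i)\<close> moves to \<open>i\<close>; the coordinates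
        1 and \<open>k\<close> take the free values \<open>q\<close> and \<open>p\<close>.\<close>
      define y where "y i = (if i = 1 then q else if i = k then p else x (Suc i))" for i
      have y: "y 1 = q" "y k = p" "\<And>i. i \<in> {2..<k} \<Longrightarrow> y i = x (Suc i)"
        using k by (auto simp: y_def)
      have c2: "c + 1 - u = Suc (Suc (c - 1 - u))" "c + 1 - Suc u = Suc (c - 1 - u)"
        "c + 1 - Suc (Suc u) = c - 1 - u" "c - u = Suc (c - 1 - u)" "c - Suc u = c - 1 - u"
        using u nc by auto
      have h11: "ent_hess k N S 1 1 = r u"
        and hk1: "ent_hess k N S k 1 = r (Suc u)"
        and hkk: "ent_hess k N S k k = r (Suc (Suc u))"
        and h1l: "ent_hess k N S 1 i = l i u"
        and hkl: "ent_hess k N S k i = l i (Suc u)"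
        and hll: "ent_hess k N S i j = m i j u" for i j
        unfolding r_def l_def m_def c2 S_def state_Suc_first state_Suc_last[OF k]
        by (simp_all add: ac_simps)
      have L1: "(\<Sum>i=2..<k. y i * l i v) = L v" for v
        unfolding L_def by (intro sum.cong) (simp_all add: y)
      have M1: "(\<Sum>i=2..<k. \<Sum>j=2..<k. y i * y j * m i j u) = M u"
        unfolding M_def by (intro sum.cong refl) (simp_all add: y)
      have e1: "hess_form {1..k} (ent_hess k N S) (\<lambda>l. if l = 1 then 1 else 0) v =
          (\<Sum>j=1..k. v j * ent_hess k N S 1 j)" for v
        using k by (intro hess_form_indicator) auto
      have "hess_form {1..k} (ent_hess k N S) y y \<le> 0"
      proof (rule lorentzian_orthogonal_nonpos[OF Suc.IH])
        show "hess_form {1..k} (ent_hess k N S)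
            (\<lambda>l. if l = 1 then 1 else 0) (\<lambda>l. if l = 1 then 1 else 0) > 0"
          unfolding e1 sum_split_first_last[OF k] h11 using k pos by simp
        show "hess_form {1..k} (ent_hess k N S) (\<lambda>l. if l = 1 then 1 else 0) y = 0"
        proof -
          have "ent_hess k N S 1 k = r (Suc u)"
            by (subst ent_hess_commute) (rule hk1)
          then have "(\<Sum>j=1..k. y j * ent_hess k N S 1 j) = p * r (Suc u) + q * r u + L u"
            unfolding sum_split_first_last[OF k] y(1,2) h11 by (simp only: h1l L1)
          then show ?thesis using orth unfolding e1 by (simp only: algebra_simps)
        qed
      qed (rule ent_hess_commute)
      also have "hess_form {1..k} (ent_hess k N S) y y =
          p\<^sup>2 * r (Suc (Suc u)) + 2 * p * q * r (Suc u) + q\<^sup>2 * r u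
          + 2 * p * L (Suc u) + 2 * q * L u + M u"
        unfolding hess_form_split[where \<sigma> = "\<lambda>l. l", OF sum_split_first_last[OF k] ent_hess_commute]
          h11 hk1 hkk y(1,2)
        unfolding h1l hkl L1 unfolding hll M1 ..
      finally show "p\<^sup>2 * r (Suc (Suc u)) + 2 * p * q * r (Suc u) + q\<^sup>2 * r u
          + 2 * p * L (Suc u) + 2 * q * L u + M u \<le> 0" .
    next
      \<comment> \<open>Here \<open>r u\<close> is the value at
        \<open>state k (c - u) t u + evec 1\<close>. By \<open>ent_support\<close> its vanishing
        forces the values with \<open>evec i\<close> instead of \<open>evec 1\<close> to vanish;
        \<open>i = k\<close> gives \<open>r (Suc u)\<close>, the other \<open>i\<close> give
        \<open>L u\<close>.\<close>
      fix u assume u: "u \<le> n" and z: "r u = 0"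
      have c2: "c + 1 - u = Suc (c - u)" "c + 1 - Suc u = c - u" using u nc by auto
      have z': "ent k N (state k (c - u) t u + evec 1) = 0"
        using z unfolding r_def c2 state_Suc_first by simp
      have supp: "ent k N (state k (c - u) t u + evec i) = 0" if "i \<in> {1..k}" for i
        using ent_support[OF k that] z' by fastforce
      have "r (Suc u) = 0"
        using supp[of k] k unfolding r_def c2 state_Suc_last[OF k] by simp
      moreover have "L u = 0"
        unfolding L_def by (intro sum.neutral) (auto simp: l_def supp)
      ultimately show "r (Suc u) = 0 \<and> L u = 0" ..
    next
      fix u assume u: "u < n" and z: "r u = 0"
      have c2: "c + 1 - u = Suc (Suc (c - 1 - u))" using u nc by auto
      define S where "S = state k (c - 1 - u) t u"
      have z': "ent k N (S + evec 1 + evec 1) = 0"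
        using z unfolding r_def c2 state_Suc_first S_def by simp
      have supp1: "ent k N (S + evec 1 + evec i) = 0" if "i \<in> {1..k}" for i
        using ent_support[OF k that] z' by fastforce
      \<comment> \<open>A second use of \<open>ent_support\<close> spreads the zero from the first
        column to the whole matrix.\<close>
      have supp2: "ent k N (S + evec i + evec j) = 0" if "i \<in> {1..k}" "j \<in> {1..k}" for i j
      proof -
        have "ent k N (S + evec i + evec 1) = 0" using supp1[OF that(1)] by (simp add: ac_simps)
        then show ?thesis using ent_support[OF k that(2), of N "S + evec i"] by fastforce
      qed
      show "M u = 0"
      proof -
        have "m i j u = 0" if "i \<in> {2..<k}" "j \<in> {2..<k}" for i j
          using supp2[of i j] that unfolding m_def S_def[symmetric] by simp
        then show ?thesis unfolding M_def by (intro sum.neutral ballI) simp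
      qed
    qed (use nonneg hyper in auto)
    \<comment> \<open>The coefficient of \<open>r n\<close> is that of the entries (1,1) and (1,2)
      together: \<open>(x 1)\<^sup>2 + 2 * x 1 * x 2 = 2 * \<zeta> * x 1 - (x
      1)\<^sup>2\<close>.\<close>
    also have "\<zeta>\<^sup>2 * (\<Sum>u<n. r u) + 2 * \<zeta> * (\<Sum>u<n. L u) + (\<Sum>u<n. M u)
        + r n * (2 * \<zeta> * x 1 - (x 1)\<^sup>2) + r (Suc n) * (x 1)\<^sup>2 + 2 * x 1 * L n
      = hess_form {1..k} (ent_hess k (Suc N) t) x x"
    proof -
      have s1: "(\<Sum>i=2..<k. x (Suc i) * ent_hess k (Suc N) t 1 (Suc i)) = (\<Sum>u<n. L u) + L n"
        unfolding sumL L_def[of n] sum.distrib[symmetric]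
        by (intro sum.cong refl) (simp only: H1l distrib_left)
      have s2: "(\<Sum>i=2..<k. x (Suc i) * ent_hess k (Suc N) t 2 (Suc i)) = (\<Sum>u<n. L u)"
        unfolding sumL by (intro sum.cong refl) (simp add: H2l del: ent.simps)
      have s3: "(\<Sum>i=2..<k. \<Sum>j=2..<k. x (Suc i) * x (Suc j) * ent_hess k (Suc N) t (Suc i) (Suc j))
          = (\<Sum>u<n. M u)"
        unfolding sumM by (intro sum.cong refl) (simp add: Hll del: ent.simps)
      show ?thesis
        unfolding hess_form_split[where \<sigma> = Suc, OF sum_split_first_two[OF k] ent_hess_commute]
          s1 s2 s3 H11 H12 H22 \<zeta>_def
        by (simp add: algebra_simps power2_eq_square)
    qed
    finally show ?thesis .
  qed
  then show ?case unfolding lorentzian_def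
    by (intro exI[of _ "ent_hess k (Suc N) t 2"]) blast
qed

lemma ent_log_concave:
  assumes "k \<ge> 2" "i \<in> {1..k}" "j \<in> {1..k}"
  shows "ent k N (t + evec i + evec i) * ent k N (t + evec j + evec j)
    \<le> (ent k N (t + evec i + evec j))\<^sup>2"
proof -
  have "ent_hess k N t i i * ent_hess k N t j j \<le> (ent_hess k N t i j)\<^sup>2"
    using assms by (intro lorentzian_minor[OF ent_lorentzian ent_hess_commute]) auto
  then show ?thesis by (simp flip: of_nat_mult of_nat_power)
qed

section \<open>Flows on the distance graph\<close>

text \<open>
  A flow is determined by its values \<open>g\<close> on the non-slack arcs: its value on the slack arc with
  tail \<open>i\<close> is \<open>i - window k g i\<close>. Truncation in \<open>i - l\<close> is harmless because \<open>g 0 = 0\<close>.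
\<close>

definition window :: "nat \<Rightarrow> (nat \<Rightarrow> nat) \<Rightarrow> nat \<Rightarrow> nat" where
  "window k g i = (\<Sum>l<k. g (i - l))"

text \<open>With \<open>d = N + k - 1\<close> the non-slack arcs have the tails
  \<open>1, ..., N - 1\<close>. The window bound makes the slack flows nonnegative. For
  \<open>s\<close> of sum \<open>N\<close> the slack flow at \<open>N\<close> comes out as
  \<open>N\<close> minus \<open>s 2 + ... + s k\<close>, which is \<open>s 1\<close>.\<close>

definition nonslack_flows :: "nat \<Rightarrow> nat \<Rightarrow> (nat \<Rightarrow> nat) \<Rightarrow> (nat \<Rightarrow> nat) set" where
  "nonslack_flows k N s =
     {g. (\<forall>i. i \<notin> {1..<N} \<longrightarrow> g i = 0) \<and> (\<forall>i<N. window k g i \<le> i) \<and>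
         (\<forall>i\<in>{1..k - 1}. g (N - i) = s (i + 1))}"

lemma window_Suc_right: "window (Suc k) g i = window k g i + g (i - k)"
  by (simp add: window_def)

lemma window_Suc_left: "window (Suc k) g i = g i + window k g (i - 1)"
  unfolding window_def by (subst sum.lessThan_Suc_shift) simp

text \<open>Both sides are \<open>window (Suc k) g v\<close>, split at its two ends. In terms of
  windows this is flow conservation at \<open>v\<close>.\<close>

lemma window_step:
  assumes "k \<ge> 1"
  shows "window k g v + g (v - k) = g v + window k g (v - 1)"
  using window_Suc_right[of k g v] window_Suc_left[of k g v] by simp

lemma sum_state:
  assumes "k \<ge> 2" "u < s 1" "(\<Sum>l=1..k. s l) = Suc N"
  shows "(\<Sum>l=1..k. state k (s 1 + s 2 - 1 - u) s u l) = N"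
proof -
  have "{1..k} = insert k (insert 1 {2..<k})" using assms(1) by auto
  then have "(\<Sum>l=1..k. state k (s 1 + s 2 - 1 - u) s u l)
      = u + (s 1 + s 2 - 1 - u) + (\<Sum>l=2..<k. s (Suc l))"
    using assms(1) by (simp add: state_def)
  moreover have "{1..k} = insert 1 (insert 2 {Suc 2..<Suc k})" using assms(1) by auto
  then have "(\<Sum>l=1..k. s l) = s 1 + (s 2 + sum s {Suc 2..<Suc k})" by simp
  then have "(\<Sum>l=1..k. s l) = s 1 + s 2 + (\<Sum>l=2..<k. s (Suc l))"
    by (simp only: sum.shift_bounds_Suc_ivl add.assoc)
  ultimately show ?thesis using assms(2,3) by simp
qed

lemma sum_split_first: "k \<ge> 1 \<Longrightarrow> (\<Sum>l=1..k. s l) = s 1 + (\<Sum>i<k - 1. s (i + 2))"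
  for s :: "nat \<Rightarrow> nat"
proof -
  assume "k \<ge> 1"
  then obtain m where m: "k = Suc m" by (cases k) auto
  have "(\<Sum>l=1..k. s l) = (\<Sum>l<Suc m. s (Suc l))"
    unfolding m by (rule sum.reindex_bij_witness[where i = Suc and j = "\<lambda>l. l - 1"]) auto
  then show ?thesis by (simp add: sum.lessThan_Suc_shift m del: sum.lessThan_Suc)
qed

text \<open>The \<open>k - 1\<close> positions ending at \<open>N - 1\<close> are the tails of the
  arcs with prescribed flow.\<close>

lemma window_end:
  assumes k: "k \<ge> 1" and g: "\<And>i. i \<in> {1..k - 1} \<Longrightarrow> g (N - i) = s (i + 1)"
  shows "window (k - 1) g (N - 1) = (\<Sum>i<k - 1. s (i + 2))"
  unfolding window_def
proof (intro sum.cong refl)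
  fix l assume "l \<in> {..<k - 1}"
  then show "g (N - 1 - l) = s (l + 2)" using g[of "l + 1"] by simp
qed

text \<open>Deleting the value \<open>s 2\<close> at \<open>N\<close> exposes
  \<open>u = g (Suc N - k)\<close> as the new last prescribed value. The only window bound lost is
  the one at \<open>N\<close>, \<open>s 2 + ... + s k + u \<le> N\<close>, and it amounts to
  \<open>u < s 1\<close> because \<open>s\<close> has sum \<open>Suc N\<close>.\<close>

lemma nonslack_flows_Suc:
  assumes k: "k \<ge> 2" and w: "(\<Sum>l=1..k. s l) = Suc N"
  shows "nonslack_flows k (Suc N) s =
    (\<Union>u<s 1. (\<lambda>g. g(N := s 2)) ` nonslack_flows k N (state k (s 1 + s 2 - 1 - u) s u))"
    (is "?L = ?R")
proof
  have w': "s 1 + (\<Sum>i<k - 1. s (i + 2)) = Suc N" using sum_split_first[of k s] k w by simp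
  show "?L \<subseteq> ?R"
  proof
    fix g assume "g \<in> ?L"
    then have supp: "\<And>i. i \<notin> {1..<Suc N} \<Longrightarrow> g i = 0"
      and win: "\<And>i. i < Suc N \<Longrightarrow> window k g i \<le> i"
      and st: "\<And>i. i \<in> {1..k - 1} \<Longrightarrow> g (Suc N - i) = s (i + 1)"
      unfolding nonslack_flows_def by auto
    define u where "u = g (Suc N - k)"
    have "window k g N = window (k - 1) g N + g (N - (k - 1))"
      using k window_Suc_right[of "k - 1" g N] by simp
    also have "window (k - 1) g N = (\<Sum>i<k - 1. s (i + 2))"
      using window_end[of k g "Suc N" s] st k by simp
    also have "g (N - (k - 1)) = u" using k by (simp add: u_def)
    finally have u: "u < s 1" using win[of N] w' by simp
    define g' where "g' = g(N := 0)"
    \<comment> \<open>For \<open>N = 0\<close> truncation makes \<open>N - i\<close> the updated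
      position itself, where \<open>g\<close> is 0 anyway.\<close>
    have same: "g' (N - i) = g (N - i)" if "i \<ge> 1" for i
      using that supp[of 0] by (cases "N = 0") (auto simp: g'_def)
    have "window k g' i = window k g i" if "i < N" for i
      using that by (auto simp: window_def g'_def intro!: sum.cong)
    moreover have "g' (N - i) = state k (s 1 + s 2 - 1 - u) s u (i + 1)" if "i \<in> {1..k - 1}" for i
      using that k st[of "i + 1"] by (auto simp: same state_def u_def)
    ultimately have "g' \<in> nonslack_flows k N (state k (s 1 + s 2 - 1 - u) s u)"
      using win supp unfolding nonslack_flows_def by (auto simp: g'_def)
    moreover have "g = g'(N := s 2)" using st[of 1] k by (simp add: g'_def numeral_2_eq_2 fun_upd_idem)
    ultimately show "g \<in> ?R" using u by blast
  qed
  show "?R \<subseteq> ?L"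
  proof
    fix g assume "g \<in> ?R"
    then obtain u g' where u: "u < s 1" and g: "g = g'(N := s 2)"
      and "g' \<in> nonslack_flows k N (state k (s 1 + s 2 - 1 - u) s u)" by blast
    then have supp: "\<And>i. i \<notin> {1..<N} \<Longrightarrow> g' i = 0"
      and win: "\<And>i. i < N \<Longrightarrow> window k g' i \<le> i"
      and st: "\<And>i. i \<in> {1..k - 1} \<Longrightarrow> g' (N - i) = state k (s 1 + s 2 - 1 - u) s u (i + 1)"
      unfolding nonslack_flows_def by auto
    \<comment> \<open>For \<open>N = 0\<close> the update hits position 0, where a flow must vanish;
      the sum 1 is then used up by \<open>s 1 > u\<close>.\<close>
    have s2: "s 2 = 0" if "N = 0"
    proof -
      have "(\<Sum>i<k - 1. s (i + 2)) = 0" using w' u that by linarith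
      then show ?thesis using k by (auto simp: numeral_2_eq_2 dest: bspec[of _ _ 0])
    qed
    have same: "g (N - i) = g' (N - i)" if "i \<ge> 1" for i
      using that s2 supp[of 0] by (cases "N = 0") (auto simp: g)
    have ends: "g (Suc N - i) = s (i + 1)" if i: "i \<in> {1..k - 1}" for i
    proof (cases "i = 1")
      case True
      then show ?thesis by (simp add: g numeral_2_eq_2)
    next
      case False
      then have i1: "i - 1 \<ge> 1" "i - 1 \<in> {1..k - 1}" using i by auto
      have "g (N - (i - 1)) = state k (s 1 + s 2 - 1 - u) s u i"
        using same[OF i1(1)] st[OF i1(2)] i1(1) by simp
      then show ?thesis using i False by (auto simp: state_def)
    qed
    have "window k g i \<le> i" if "i < Suc N" for i
    proof (cases "i = N")
      case True
      have "window k g N = window (k - 1) g N + g (N - (k - 1))"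
        using k window_Suc_right[of "k - 1" g N] by simp
      also have "window (k - 1) g N = (\<Sum>i<k - 1. s (i + 2))"
        using window_end[of k g "Suc N" s] ends k by simp
      also have "g (N - (k - 1)) = u"
        using same[of "k - 1"] st[of "k - 1"] k by (simp add: state_def)
      finally show ?thesis using u w' True by simp
    next
      case False
      then have "window k g i = window k g' i"
        using that by (auto simp: window_def g intro!: sum.cong)
      then show ?thesis using win[of i] that False by simp
    qed
    moreover have "g i = 0" if "i \<notin> {1..<Suc N}" for i
      using that supp[of i] s2 by (auto simp: g)
    ultimately show "g \<in> ?L" using ends unfolding nonslack_flows_def by auto
  qed
qed

text \<open>The union in \<open>nonslack_flows_Suc\<close> is disjoint, since \<open>u\<close> can
  be read off at position \<open>N - (k - 1)\<close>, and the update is injective, since the old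
  value at \<open>N\<close> is 0. So the cardinalities obey the recursion of
  \<open>ent\<close>.\<close>

lemma card_nonslack_flows:
  assumes k: "k \<ge> 2"
  shows "(\<Sum>l=1..k. s l) = N \<Longrightarrow>
    finite (nonslack_flows k N s) \<and> card (nonslack_flows k N s) = ent k N s"
proof (induction N arbitrary: s)
  case 0
  then have z: "\<forall>l\<in>{1..k}. s l = 0" by simp
  then have "nonslack_flows k 0 s = {\<lambda>i. 0}"
    by (auto simp: nonslack_flows_def fun_eq_iff)
  then show ?case using z by simp
next
  case (Suc N)
  define A where "A u = nonslack_flows k N (state k (s 1 + s 2 - 1 - u) s u)" for u
  have A: "finite (A u)" "card (A u) = ent k N (state k (s 1 + s 2 - 1 - u) s u)" if "u < s 1" for u
    using Suc.IH[OF sum_state[of k u s N]] that k Suc.prems unfolding A_def by auto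
  have N0: "g N = 0" if "g \<in> A u" for g u
    using that unfolding A_def nonslack_flows_def by auto
  have last: "g (N - (k - 1)) = u" if "g \<in> A u" for g u
    using that k unfolding A_def nonslack_flows_def by (auto simp: state_def dest!: bspec[of _ _ "k - 1"])
  have inj: "g = h \<and> u = v"
    if "g \<in> A u" "h \<in> A v" "g(N := s 2) = h(N := s 2)" for g h u v
  proof -
    have "g = (g(N := s 2))(N := 0)" "h = (h(N := s 2))(N := 0)"
      using N0[OF that(1)] N0[OF that(2)] by (auto simp: fun_eq_iff)
    then have "g = h" using that(3) by metis
    then show ?thesis using last that by blast
  qed
  define B where "B u = (\<lambda>g. g(N := s 2)) ` A u" for u
  have inj_on: "inj_on (\<lambda>g. g(N := s 2)) (A u)" for u
    using inj by (blast intro: inj_onI)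
  have eq: "nonslack_flows k (Suc N) s = (\<Union>u\<in>{..<s 1}. B u)"
    using nonslack_flows_Suc[OF k Suc.prems] unfolding B_def A_def by simp
  have fin: "finite (B u)" if "u < s 1" for u
    using A that by (simp add: B_def)
  have "card (\<Union>u\<in>{..<s 1}. B u) = (\<Sum>u<s 1. card (B u))"
  proof (intro card_UN_disjoint ballI impI)
    show "B u \<inter> B v = {}" if "u \<noteq> v" for u v
      using inj that unfolding B_def by blast
  qed (use fin in auto)
  also have "\<dots> = ent k (Suc N) s"
    by (simp add: B_def card_image inj_on A)
  finally show ?case using fin eq by auto
qed

section \<open>Conservation equations and the cut formula for slack flows\<close>

lemma distance_graph_out_sum:
  assumes "\<forall>e. e \<notin> arcs (distance_graph k d) \<longrightarrow> f e = (0::nat)"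
  shows "(\<Sum>e\<in>out_arcs (distance_graph k d) v. int (f e)) = int (f (Slack v)) + int (f (NonSlack v))"
proof -
  have sub: "e \<in> out_arcs (distance_graph k d) v \<Longrightarrow> e \<in> {Slack v, NonSlack v}" for e
    by (cases e) (auto simp: distance_graph_def)
  have "e \<in> {Slack v, NonSlack v} - out_arcs (distance_graph k d) v \<Longrightarrow>
      int (f e) = 0" for e
    using assms by (cases e) (auto simp: distance_graph_def)
  then have "(\<Sum>e\<in>out_arcs (distance_graph k d) v. int (f e)) = (\<Sum>e\<in>{Slack v, NonSlack v}. int (f e))"
    using sub by (intro sum.mono_neutral_left subsetI ballI) (simp, blast, blast)
  then show ?thesis by simp
qed

lemma distance_graph_in_sum:
  assumes "\<forall>e. e \<notin> arcs (distance_graph k d) \<longrightarrow> f e = (0::nat)" "v \<ge> 1"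
  shows "(\<Sum>e\<in>in_arcs (distance_graph k d) v. int (f e)) =
    int (f (Slack (v - 1))) + int (f (NonSlack (v - k)))"
proof -
  have sub: "e \<in> in_arcs (distance_graph k d) v \<Longrightarrow> e \<in> {Slack (v - 1), NonSlack (v - k)}" for e
    by (cases e) (auto simp: distance_graph_def)
  have "e \<in> {Slack (v - 1), NonSlack (v - k)} - in_arcs (distance_graph k d) v \<Longrightarrow>
      int (f e) = 0" for e
    using assms by (cases e) (auto simp: distance_graph_def)
  then have "(\<Sum>e\<in>in_arcs (distance_graph k d) v. int (f e)) =
      (\<Sum>e\<in>{Slack (v - 1), NonSlack (v - k)}. int (f e))"
    using sub by (intro sum.mono_neutral_left subsetI ballI) (simp, blast, blast)
  then show ?thesis by simp
qed

text \<open>Missing arcs carry flow 0, and truncation sends the tails of missing incoming arcs to 0,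
  so one equation covers all vertices, including those near the ends.\<close>

lemma integral_flows_distance_graph_iff:
  "f \<in> integral_flows (distance_graph k d) a \<longleftrightarrow>
     (\<forall>i. \<not> (1 \<le> i \<and> i < d) \<longrightarrow> f (Slack i) = 0) \<and>
     (\<forall>i. \<not> (1 \<le> i \<and> i + k \<le> d) \<longrightarrow> f (NonSlack i) = 0) \<and>
     (\<forall>v\<in>{1..d}. int (f (Slack v)) + int (f (NonSlack v)) -
        (int (f (Slack (v - 1))) + int (f (NonSlack (v - k)))) = a v)"
proof -
  have "(\<forall>e. e \<notin> arcs (distance_graph k d) \<longrightarrow> f e = 0) \<longleftrightarrow>
     (\<forall>i. \<not> (1 \<le> i \<and> i < d) \<longrightarrow> f (Slack i) = 0) \<and>
     (\<forall>i. \<not> (1 \<le> i \<and> i + k \<le> d) \<longrightarrow> f (NonSlack i) = 0)"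
    (is "?Z \<longleftrightarrow> ?Z'")
  proof
    show "?Z \<Longrightarrow> ?Z'" by (auto simp: distance_graph_def)
    assume z: ?Z'
    show ?Z
    proof (intro allI impI)
      fix e assume "e \<notin> arcs (distance_graph k d)"
      then show "f e = 0" using z by (cases e) (auto simp: distance_graph_def)
    qed
  qed
  moreover have "verts (distance_graph k d) = {1..d}" by (simp add: distance_graph_def)
  then have "f \<in> integral_flows (distance_graph k d) a \<longleftrightarrow>
    (\<forall>e. e \<notin> arcs (distance_graph k d) \<longrightarrow> f e = 0) \<and>
     (\<forall>v\<in>{1..d}. int (f (Slack v)) + int (f (NonSlack v)) -
        (int (f (Slack (v - 1))) + int (f (NonSlack (v - k)))) = a v)"
    unfolding integral_flows_def mem_Collect_eq
    by (intro conj_cong refl ball_cong)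
      (simp_all only: distance_graph_out_sum distance_graph_in_sum atLeastAtMost_iff)
  ultimately show ?thesis by (simp only: conj_assoc)
qed

text \<open>The vertices up to \<open>v\<close> send out \<open>v\<close> units in total, and these
  cross the cut after \<open>v\<close>. The crossing arcs are the slack arc at \<open>v\<close> and
  the non-slack arcs whose tails lie in the window of length \<open>k\<close> ending at
  \<open>v\<close>.\<close>

lemma slack_flow_eq:
  assumes k: "k \<ge> 1" and f: "f \<in> integral_flows (distance_graph k d) (entringer_netflow d)"
  shows "v < d \<Longrightarrow> int (f (Slack v)) = int v - int (window k (\<lambda>i. f (NonSlack i)) v)"
proof (induction v)
  case 0
  then show ?case using f by (simp add: integral_flows_distance_graph_iff window_def)
next
  case (Suc v)
  have "int (f (Slack (Suc v))) + int (f (NonSlack (Suc v))) -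
      (int (f (Slack v)) + int (f (NonSlack (Suc v - k)))) = 1"
    using f Suc.prems unfolding integral_flows_distance_graph_iff entringer_netflow_def
    by (auto dest!: bspec[of _ _ "Suc v"])
  moreover have "window k (\<lambda>i. f (NonSlack i)) (Suc v) + f (NonSlack (Suc v - k)) =
      f (NonSlack (Suc v)) + window k (\<lambda>i. f (NonSlack i)) v"
    using window_step[OF k, of "\<lambda>i. f (NonSlack i)" "Suc v"] by simp
  ultimately show ?case using Suc by simp
qed

text \<open>Forgetting the slack flows is a bijection onto \<open>nonslack_flows\<close>, because
  the cut formula recovers them.\<close>

lemma entringer_eq_ent:
  assumes k: "k \<ge> 2" and N: "d + 1 = N + k" and s: "s \<in> lattice_simplex k N"
  shows "entringer k d s = ent k N (\<lambda>l. nat (s l))"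
proof -
  define t where "t = (\<lambda>l. nat (s l))"
  have nonneg: "\<forall>l\<in>{1..k}. 0 \<le> s l" and tot: "(\<Sum>l=1..k. s l) = int N"
    using s by (auto simp: lattice_simplex_def)
  have st: "s l = int (t l)" if "l \<in> {1..k}" for l using nonneg that by (simp add: t_def)
  have "int (\<Sum>l=1..k. t l) = int N" using tot st by simp
  then have w: "(\<Sum>l=1..k. t l) = N" by linarith
  then have w': "t 1 + (\<Sum>i<k - 1. t (i + 2)) = N" using sum_split_first[of k t] k by simp
  define F where "F = {f \<in> integral_flows (distance_graph k d) (entringer_netflow d).
       int (f (Slack N)) = s 1 \<and> (\<forall>i\<in>{1..k - 1}. int (f (NonSlack (N - i))) = s (i + 1))}"
  have "entringer k d s = card F"
  proof -
    have "d + 1 - k = N" using N by simp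
    then show ?thesis using nonneg unfolding entringer_def F_def Let_def by auto
  qed
  also have "bij_betw (\<lambda>f i. f (NonSlack i)) F (nonslack_flows k N t)"
    unfolding bij_betw_def
  proof
    have Nd: "N < d" using N k by simp
    show "inj_on (\<lambda>f i. f (NonSlack i)) F"
    proof (rule inj_onI)
      fix f h assume fh: "f \<in> F" "h \<in> F" and eq: "(\<lambda>i. f (NonSlack i)) = (\<lambda>i. h (NonSlack i))"
      then have fl: "f \<in> integral_flows (distance_graph k d) (entringer_netflow d)"
        "h \<in> integral_flows (distance_graph k d) (entringer_netflow d)" by (auto simp: F_def)
      have "f (Slack v) = h (Slack v)" for v
      proof (cases "v < d")
        case True
        then show ?thesis using slack_flow_eq[OF _ fl(1) True] slack_flow_eq[OF _ fl(2) True] k eq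
          by simp
      next
        case False
        then show ?thesis using fl by (simp add: integral_flows_distance_graph_iff)
      qed
      moreover have "f (NonSlack v) = h (NonSlack v)" for v using eq by metis
      ultimately show "f = h" by (metis dist_arc.exhaust ext)
    qed
    show "(\<lambda>f i. f (NonSlack i)) ` F = nonslack_flows k N t"
    proof
      show "(\<lambda>f i. f (NonSlack i)) ` F \<subseteq> nonslack_flows k N t"
      proof clarify
        fix f assume f: "f \<in> F"
        then have fl: "f \<in> integral_flows (distance_graph k d) (entringer_netflow d)"
          by (simp add: F_def)
        have "window k (\<lambda>i. f (NonSlack i)) i \<le> i" if "i < N" for i
          using slack_flow_eq[OF _ fl, of i] k that Nd by simp
        moreover have "f (NonSlack i) = 0" if "i \<notin> {1..<N}" for i
          using fl that N unfolding integral_flows_distance_graph_iff by auto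
        moreover have "f (NonSlack (N - i)) = t (i + 1)" if "i \<in> {1..k - 1}" for i
        proof -
          have "int (f (NonSlack (N - i))) = s (i + 1)" using f that unfolding F_def by blast
          then show ?thesis using st[of "i + 1"] that by auto
        qed
        ultimately show "(\<lambda>i. f (NonSlack i)) \<in> nonslack_flows k N t"
          unfolding nonslack_flows_def by auto
      qed
      show "nonslack_flows k N t \<subseteq> (\<lambda>f i. f (NonSlack i)) ` F"
      proof
        fix g assume "g \<in> nonslack_flows k N t"
        then have supp: "\<And>i. i \<notin> {1..<N} \<Longrightarrow> g i = 0"
          and win: "\<And>i. i < N \<Longrightarrow> window k g i \<le> i"
          and ends: "\<And>i. i \<in> {1..k - 1} \<Longrightarrow> g (N - i) = t (i + 1)"
          unfolding nonslack_flows_def by auto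
        \<comment> \<open>The slack values are those forced by the cut formula; \<open>win'\<close>
          below shows that the subtraction does not truncate.\<close>
        define f where "f e = (case e of NonSlack i \<Rightarrow> g i
          | Slack i \<Rightarrow> if i < d then i - window k g i else 0)" for e
        have winN: "window k g N = (\<Sum>i<k - 1. t (i + 2))"
        proof -
          have "window k g N = g N + window (k - 1) g (N - 1)"
            using window_Suc_left[of "k - 1" g N] k by simp
          then show ?thesis using window_end[of k g N t] ends k supp[of N] by simp
        qed
        \<comment> \<open>From \<open>N\<close> on, \<open>g\<close> vanishes, so moving the window
          to the right can only shrink it, and at \<open>N\<close> it is
          \<open>s 2 + ... + s k\<close>, which is at most \<open>N\<close>.\<close>
        have win': "window k g i \<le> i" for i
        proof (cases "i < N")
          case False
          have "window k g (N + j) \<le> window k g N" for j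
          proof (induction j)
            case (Suc j)
            then show ?case using window_step[of k g "N + Suc j"] k supp[of "N + Suc j"] by simp
          qed simp
          from this[of "i - N"] show ?thesis using False winN w' by simp
        qed (use win in auto)
        have slack: "int (f (Slack i)) = int i - int (window k g i)" if "i < d" for i
          using that win'[of i] by (simp add: f_def)
        have "int (f (Slack v)) + int (f (NonSlack v)) -
            (int (f (Slack (v - 1))) + int (f (NonSlack (v - k)))) = entringer_netflow d v"
          if v: "v \<in> {1..d}" for v
        proof -
          have step: "window k g v + g (v - k) = g v + window k g (v - 1)"
            using window_step k by simp
          show ?thesis
          proof (cases "v = d")
            case False
            then have "v < d" "v - 1 < d" using v by auto
            moreover have "f (NonSlack i) = g i" for i by (simp add: f_def)
            ultimately show ?thesis using v slack[of v] slack[of "v - 1"] step False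
              by (simp add: entringer_netflow_def of_nat_diff del: One_nat_def)
          next
            case True
            \<comment> \<open>The window at the sink covers the positions from
              \<open>d - k + 1 = N\<close> to \<open>d\<close>, where \<open>g\<close>
              vanishes.\<close>
            have "window k g d = 0"
              unfolding window_def
            proof (intro sum.neutral ballI)
              fix l assume "l \<in> {..<k}"
              then show "g (d - l) = 0" using N by (intro supp) auto
            qed
            moreover have "g d = 0" using Nd by (intro supp) auto
            ultimately show ?thesis using True v slack[of "d - 1"] step
              by (simp add: entringer_netflow_def f_def)
          qed
        qed
        moreover have "f (Slack i) = 0" if "\<not> (1 \<le> i \<and> i < d)" for i
          using that by (auto simp: f_def)
        moreover have "f (NonSlack i) = 0" if "\<not> (1 \<le> i \<and> i + k \<le> d)" for i
          using that N by (auto simp: f_def intro!: supp)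
        ultimately have "f \<in> integral_flows (distance_graph k d) (entringer_netflow d)"
          unfolding integral_flows_distance_graph_iff by blast
        moreover have "int (f (Slack N)) = s 1"
        proof -
          have "s 1 = int (t 1)" using st[of 1] k by simp
          then show ?thesis using slack[OF Nd] winN w' by linarith
        qed
        moreover have "int (f (NonSlack (N - i))) = s (i + 1)" if "i \<in> {1..k - 1}" for i
          using ends[OF that] st[of "i + 1"] that by (auto simp: f_def)
        ultimately have "f \<in> F" unfolding F_def by blast
        moreover have "g = (\<lambda>i. f (NonSlack i))" by (simp add: f_def)
        ultimately show "g \<in> (\<lambda>f i. f (NonSlack i)) ` F" by blast
      qed
    qed
  qed
  then have "card F = card (nonslack_flows k N t)" by (rule bij_betw_same_card)
  also have "\<dots> = ent k N t" using card_nonslack_flows[OF k w] by simp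
  finally show ?thesis by (simp add: t_def)
qed

section \<open>Log-concavity along root directions\<close>

lemma entringer_neg: "\<exists>l\<in>{1..k}. s l < 0 \<Longrightarrow> entringer k d s = 0"
  by (simp add: entringer_def)

theorem theorem6p11:
  fixes k d N i j :: nat and s :: "nat \<Rightarrow> int"
  assumes "k \<ge> 2"
    and "int N = int d - int k + 1"
    and "s \<in> lattice_simplex k N"
    and "1 \<le> i" and "i < j" and "j \<le> k"
  shows "(entringer k d s)\<^sup>2 \<ge>
           entringer k d (s - basis_vec i + basis_vec j) *
           entringer k d (s + basis_vec i - basis_vec j)"
proof (cases "1 \<le> s i \<and> 1 \<le> s j")
  case False
  let ?p = "s - basis_vec i + basis_vec j" and ?q = "s + basis_vec i - basis_vec j"
  \<comment> \<open>If \<open>s i\<close> or \<open>s j\<close> is 0, one of the two neighbours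
    leaves the simplex and the product is 0 by convention.\<close>
  have "?p i < 0 \<or> ?q j < 0" using False assms(5) by (auto simp: basis_vec_def)
  moreover have "i \<in> {1..k}" "j \<in> {1..k}" using assms by auto
  ultimately have "(\<exists>l\<in>{1..k}. ?p l < 0) \<or> (\<exists>l\<in>{1..k}. ?q l < 0)" by blast
  then have "entringer k d ?p = 0 \<or> entringer k d ?q = 0"
    by (rule disj_forward) (erule entringer_neg)+
  then show ?thesis by auto
next
  case True
  \<comment> \<open>The common base point: \<open>s\<close> is \<open>t + evec i + evec j\<close>,
    and its neighbours are \<open>t + evec j + evec j\<close> and
    \<open>t + evec i + evec i\<close>. The subtraction is exact since \<open>s i\<close> and
    \<open>s j\<close> are positive and \<open>i \<noteq> j\<close>.\<close>
  define t where "t l = nat (s l) - evec i l - evec j l" for l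
  have N: "d + 1 = N + k" using assms(2) by linarith
  have ij: "i \<in> {1..k}" "j \<in> {1..k}" "i \<noteq> j" using assms by auto
  have nonneg: "\<And>l. 0 \<le> s l" and off: "\<And>l. l \<notin> {1..k} \<Longrightarrow> s l = 0"
    and tot: "(\<Sum>l=1..k. s l) = int N"
    using assms(3) by (auto simp: lattice_simplex_def)
  have sum_basis: "(\<Sum>l=1..k. basis_vec a l) = 1" if "a \<in> {1..k}" for a
    using that by (simp add: basis_vec_def)
  have swap: "s - basis_vec a + basis_vec b \<in> lattice_simplex k N"
    if "a \<in> {1..k}" "b \<in> {1..k}" "1 \<le> s a" for a b
  proof -
    have "(\<Sum>l=1..k. (s - basis_vec a + basis_vec b) l) = int N"
      using tot sum_basis that by (simp add: sum.distrib sum_subtractf)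
    moreover have "0 \<le> (s - basis_vec a + basis_vec b) l" for l
      using nonneg[of l] that by (auto simp: basis_vec_def)
    moreover have "(s - basis_vec a + basis_vec b) l = 0" if "l \<notin> {1..k}" for l
      using off[OF that] that \<open>a \<in> _\<close> \<open>b \<in> _\<close> by (auto simp: basis_vec_def)
    ultimately show ?thesis unfolding lattice_simplex_def by blast
  qed
  have "(\<lambda>l. nat ((s - basis_vec i + basis_vec j) l)) = t + evec j + evec j"
    "(\<lambda>l. nat ((s - basis_vec j + basis_vec i) l)) = t + evec i + evec i"
    "(\<lambda>l. nat (s l)) = t + evec i + evec j"
    using True nonneg ij(3) by (auto simp: fun_eq_iff t_def evec_def basis_vec_def nat_add_distrib nat_diff_distrib)
  then have "entringer k d (s - basis_vec i + basis_vec j) = ent k N (t + evec j + evec j)"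
    "entringer k d (s - basis_vec j + basis_vec i) = ent k N (t + evec i + evec i)"
    "entringer k d s = ent k N (t + evec i + evec j)"
    using entringer_eq_ent[OF assms(1) N swap[of i j]] entringer_eq_ent[OF assms(1) N swap[of j i]]
      entringer_eq_ent[OF assms(1) N assms(3)] ij True by simp_all
  moreover have "s + basis_vec i - basis_vec j = s - basis_vec j + basis_vec i" by simp
  ultimately show ?thesis
    using ent_log_concave[OF assms(1) ij(1,2), of N t] by (simp only: mult.commute)
qed

end
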